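(* Let $\langle M,\in^M\rangle$ be a countable model of ${\rm ZF}$, presented with domain $\omega$, and let $\mathbb{P}\in M$ be a notion of forcing in $M$ (a partial order in the sense of $M$). Then there is an $M$-generic filter $G\subseteq\mathbb{P}$ which is computable from the atomic diagram of $\langle M,\in^M\rangle$ (in the signature $\{\in\}$).
   Context: A filter $G\subseteq\mathbb{P}$ (upward closed, downward directed subset of the set of $M$-elements of $\mathbb{P}$) is $M$-generic if it meets every $D\in M$ which $M$ thinks is a dense subset of $\mathbb{P}$. Ordered pairs in $M$ are Kuratowski pairs $(p,q)=\{\{p\},\{p,q\}\}$. The atomic diagram of $\langle M,\in^M\rangle$ on domain $\omega$ is essentially the relation $\in^M\subseteq\omega^2$. *)

theory Defs
  imports Main
begin

text \<open>
  A structure in the signature of set theory with domain \<open>\<omega>\<close> is a relation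
  \<open>E :: nat \<Rightarrow> nat \<Rightarrow> bool\<close>, where \<open>E x y\<close> is read "M thinks that x is an element of y";
  equality is true equality of natural numbers. Nothing is assumed about well-foundedness of \<open>E\<close>.
\<close>

section \<open>Models of ZF\<close>

datatype fm = Mem nat nat | Eql nat nat | Neg fm | Conj fm fm | Exi nat fm

text \<open>Variables are named by natural numbers; an assignment also supplies the parameters.\<close>

primrec sat :: "(nat \<Rightarrow> nat \<Rightarrow> bool) \<Rightarrow> (nat \<Rightarrow> nat) \<Rightarrow> fm \<Rightarrow> bool" where
  "sat E v (Mem i j) \<longleftrightarrow> E (v i) (v j)"
| "sat E v (Eql i j) \<longleftrightarrow> v i = v j"
| "sat E v (Neg \<phi>) \<longleftrightarrow> \<not> sat E v \<phi>"
| "sat E v (Conj \<phi> \<psi>) \<longleftrightarrow> sat E v \<phi> \<and> sat E v \<psi>"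
| "sat E v (Exi i \<phi>) \<longleftrightarrow> (\<exists>x. sat E (v(i := x)) \<phi>)"

definition extensionality :: "(nat \<Rightarrow> nat \<Rightarrow> bool) \<Rightarrow> bool" where
  "extensionality E \<longleftrightarrow> (\<forall>x y. (\<forall>z. E z x \<longleftrightarrow> E z y) \<longrightarrow> x = y)"

definition foundation :: "(nat \<Rightarrow> nat \<Rightarrow> bool) \<Rightarrow> bool" where
  "foundation E \<longleftrightarrow> (\<forall>x. (\<exists>y. E y x) \<longrightarrow> (\<exists>y. E y x \<and> \<not> (\<exists>z. E z x \<and> E z y)))"

definition pairing :: "(nat \<Rightarrow> nat \<Rightarrow> bool) \<Rightarrow> bool" where
  "pairing E \<longleftrightarrow> (\<forall>x y. \<exists>z. \<forall>w. E w z \<longleftrightarrow> w = x \<or> w = y)"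

definition union_axiom :: "(nat \<Rightarrow> nat \<Rightarrow> bool) \<Rightarrow> bool" where
  "union_axiom E \<longleftrightarrow> (\<forall>x. \<exists>u. \<forall>z. E z u \<longleftrightarrow> (\<exists>y. E y x \<and> E z y))"

definition power_set :: "(nat \<Rightarrow> nat \<Rightarrow> bool) \<Rightarrow> bool" where
  "power_set E \<longleftrightarrow> (\<forall>x. \<exists>u. \<forall>z. E z u \<longleftrightarrow> (\<forall>w. E w z \<longrightarrow> E w x))"

definition infinity_axiom :: "(nat \<Rightarrow> nat \<Rightarrow> bool) \<Rightarrow> bool" where
  "infinity_axiom E \<longleftrightarrow>
     (\<exists>x. (\<exists>e. E e x \<and> (\<forall>w. \<not> E w e)) \<and>
          (\<forall>y. E y x \<longrightarrow> (\<exists>s. E s x \<and> (\<forall>w. E w s \<longleftrightarrow> E w y \<or> w = y))))"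

text \<open>
  In the two schemes variable 0 (and 1) is the argument (and value), all other variables are
  parameters. The set asserted to exist is chosen after the assignment \<open>v\<close>, so it cannot occur
  in \<open>\<phi>\<close> as a parameter and no freshness condition is needed.
\<close>

definition separation :: "(nat \<Rightarrow> nat \<Rightarrow> bool) \<Rightarrow> bool" where
  "separation E \<longleftrightarrow> (\<forall>\<phi> v a. \<exists>b. \<forall>x. E x b \<longleftrightarrow> E x a \<and> sat E (v(0 := x)) \<phi>)"

definition replacement :: "(nat \<Rightarrow> nat \<Rightarrow> bool) \<Rightarrow> bool" where
  "replacement E \<longleftrightarrow>
     (\<forall>\<phi> v a. (\<forall>x. E x a \<longrightarrow> (\<exists>!y. sat E (v(0 := x, 1 := y)) \<phi>)) \<longrightarrow>
        (\<exists>b. \<forall>y. E y b \<longleftrightarrow> (\<exists>x. E x a \<and> sat E (v(0 := x, 1 := y)) \<phi>)))"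

definition model_ZF :: "(nat \<Rightarrow> nat \<Rightarrow> bool) \<Rightarrow> bool" where
  "model_ZF E \<longleftrightarrow>
     extensionality E \<and> foundation E \<and> pairing E \<and> union_axiom E \<and> power_set E \<and>
     infinity_axiom E \<and> separation E \<and> replacement E"

section \<open>Forcing notions and generic filters\<close>

definition is_upair :: "(nat \<Rightarrow> nat \<Rightarrow> bool) \<Rightarrow> nat \<Rightarrow> nat \<Rightarrow> nat \<Rightarrow> bool" where
  "is_upair E x y z \<longleftrightarrow> (\<forall>w. E w z \<longleftrightarrow> w = x \<or> w = y)"

text \<open>\<open>is_opair E p q r\<close>: in M, r is the Kuratowski pair \<open>{{p}, {p, q}}\<close>.\<close>

definition is_opair :: "(nat \<Rightarrow> nat \<Rightarrow> bool) \<Rightarrow> nat \<Rightarrow> nat \<Rightarrow> nat \<Rightarrow> bool" where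
  "is_opair E p q r \<longleftrightarrow> (\<exists>s t. is_upair E p p s \<and> is_upair E p q t \<and> is_upair E s t r)"

definition related :: "(nat \<Rightarrow> nat \<Rightarrow> bool) \<Rightarrow> nat \<Rightarrow> nat \<Rightarrow> nat \<Rightarrow> bool" where
  "related E L p q \<longleftrightarrow> (\<exists>r. is_opair E p q r \<and> E r L)"

text \<open>
  \<open>notion_of_forcing E \<PP> P L\<close>: in M, \<open>\<PP>\<close> is the ordered pair \<open>(P, L)\<close> of a nonempty set P and a
  partial order L on P. The relation \<open>related E L p q\<close> says that p is a stronger condition than q.
\<close>

definition notion_of_forcing :: "(nat \<Rightarrow> nat \<Rightarrow> bool) \<Rightarrow> nat \<Rightarrow> nat \<Rightarrow> nat \<Rightarrow> bool" where
  "notion_of_forcing E \<PP> P L \<longleftrightarrow>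
     is_opair E P L \<PP> \<and>
     (\<exists>p. E p P) \<and>
     (\<forall>r. E r L \<longrightarrow> (\<exists>p q. E p P \<and> E q P \<and> is_opair E p q r)) \<and>
     (\<forall>p. E p P \<longrightarrow> related E L p p) \<and>
     (\<forall>p q. E p P \<and> E q P \<and> related E L p q \<and> related E L q p \<longrightarrow> p = q) \<and>
     (\<forall>p q r. E p P \<and> E q P \<and> E r P \<and> related E L p q \<and> related E L q r \<longrightarrow> related E L p r)"

definition is_dense :: "(nat \<Rightarrow> nat \<Rightarrow> bool) \<Rightarrow> nat \<Rightarrow> nat \<Rightarrow> nat \<Rightarrow> bool" where
  "is_dense E P L D \<longleftrightarrow>
     (\<forall>d. E d D \<longrightarrow> E d P) \<and> (\<forall>p. E p P \<longrightarrow> (\<exists>d. E d D \<and> related E L d p))"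

definition is_filter_on :: "(nat \<Rightarrow> nat \<Rightarrow> bool) \<Rightarrow> nat \<Rightarrow> nat \<Rightarrow> nat set \<Rightarrow> bool" where
  "is_filter_on E P L G \<longleftrightarrow>
     G \<subseteq> {p. E p P} \<and> G \<noteq> {} \<and>
     (\<forall>p\<in>G. \<forall>q. E q P \<and> related E L p q \<longrightarrow> q \<in> G) \<and>
     (\<forall>p\<in>G. \<forall>q\<in>G. \<exists>r\<in>G. related E L r p \<and> related E L r q)"

definition generic_filter :: "(nat \<Rightarrow> nat \<Rightarrow> bool) \<Rightarrow> nat \<Rightarrow> nat \<Rightarrow> nat set \<Rightarrow> bool" where
  "generic_filter E P L G \<longleftrightarrow>
     is_filter_on E P L G \<and> (\<forall>D. is_dense E P L D \<longrightarrow> (\<exists>d\<in>G. E d D))"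

section \<open>Relative computability\<close>

text \<open>
  Programs for the partial functions that are recursive relative to a binary relation \<open>R\<close> on the
  natural numbers: the class generated from zero, successor, projections and the characteristic
  function of \<open>R\<close> by composition, primitive recursion and minimisation.
  \<open>computes R f xs y\<close> means that program f with access to \<open>R\<close> halts on input xs with output y.
\<close>

datatype prog =
    Zero
  | Succ
  | Proj nat
  | Query
  | Comp prog "prog list"
  | PrimRec prog prog
  | Mu prog

inductive computes :: "(nat \<Rightarrow> nat \<Rightarrow> bool) \<Rightarrow> prog \<Rightarrow> nat list \<Rightarrow> nat \<Rightarrow> bool"
  for R :: "nat \<Rightarrow> nat \<Rightarrow> bool" where
  zero: "computes R Zero xs 0"
| succ: "computes R Succ [x] (Suc x)"
| proj: "i < length xs \<Longrightarrow> computes R (Proj i) xs (xs ! i)"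
| query: "computes R Query [x, y] (if R x y then 1 else 0)"
| comp: "list_all2 (\<lambda>g y. computes R g xs y) gs ys \<Longrightarrow> computes R f ys z \<Longrightarrow>
    computes R (Comp f gs) xs z"
| primrec_0: "computes R f xs y \<Longrightarrow> computes R (PrimRec f g) (0 # xs) y"
| primrec_Suc: "computes R (PrimRec f g) (n # xs) y \<Longrightarrow> computes R g (n # y # xs) z \<Longrightarrow>
    computes R (PrimRec f g) (Suc n # xs) z"
| mu: "computes R f (n # xs) 0 \<Longrightarrow> (\<forall>m<n. \<exists>y>0. computes R f (m # xs) y) \<Longrightarrow>
    computes R (Mu f) xs n"

inductive_cases computes_elims:
  "computes R Zero xs z"
  "computes R Succ xs z"
  "computes R (Proj i) xs z"
  "computes R Query xs z"
  "computes R (Comp f gs) xs z"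
  "computes R (PrimRec f g) (0 # xs) z"
  "computes R (PrimRec f g) (Suc n # xs) z"
  "computes R (Mu f) xs z"

lemma computes_deterministic:
  "computes R f xs y \<Longrightarrow> computes R f xs z \<Longrightarrow> z = y"
proof (induction arbitrary: z rule: computes.induct)
  case (zero xs)
  then show ?case by (rule computes_elims(1))
next
  case (succ x)
  then show ?case by (rule computes_elims(2)) simp
next
  case (proj i xs)
  from proj(2) show ?case by (rule computes_elims(3)) simp
next
  case (query x y)
  then show ?case by (rule computes_elims(4)) simp
next
  case (comp xs gs ys f z')
  from comp.prems obtain ys' where
    ys': "list_all2 (\<lambda>g y. computes R g xs y) gs ys'" "computes R f ys' z"
    by (rule computes_elims(5))
  have len: "length ys' = length ys"
    using list_all2_lengthD[OF comp(1)] list_all2_lengthD[OF ys'(1)] by simp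
  have "ys' ! i = ys ! i" if i: "i < length ys'" for i
  proof -
    have "\<forall>w. computes R (gs ! i) xs w \<longrightarrow> w = ys ! i"
      using list_all2_nthD2[OF comp(1)] i len by simp
    then show ?thesis using list_all2_nthD2[OF ys'(1) i] by blast
  qed
  then have "ys' = ys" using len by (intro nth_equalityI) simp_all
  then show ?case using comp.IH ys'(2) by blast
next
  case (primrec_0 f xs y g)
  from primrec_0.prems show ?case by (rule computes_elims(6)) (rule primrec_0.IH)
next
  case (primrec_Suc f g n xs y z')
  from primrec_Suc.prems obtain y' where
    "computes R (PrimRec f g) (n # xs) y'" "computes R g (n # y' # xs) z"
    by (rule computes_elims(7))
  then show ?case using primrec_Suc.IH by blast
next
  case (mu f n xs)
  from mu.prems have
    z: "computes R f (z # xs) 0" "\<forall>m<z. \<exists>y>0. computes R f (m # xs) y"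
    by (rule computes_elims(8), simp)+
  have "\<not> z < n"
  proof
    assume "z < n"
    then obtain y where "y > 0" "\<And>w. computes R f (z # xs) w \<Longrightarrow> w = y" using mu.IH(2) by blast
    then show False using z(1) by force
  qed
  moreover have "\<not> n < z"
  proof
    assume "n < z"
    then obtain y where "y > 0" "computes R f (n # xs) y" using z(2) by blast
    then show False using mu.IH(1) by force
  qed
  ultimately show ?case by simp
qed

definition computable_from :: "(nat \<Rightarrow> nat \<Rightarrow> bool) \<Rightarrow> nat set \<Rightarrow> bool" where
  "computable_from R A \<longleftrightarrow> (\<exists>f. \<forall>n. computes R f [n] (if n \<in> A then 1 else 0))"

end

theory Submission
  imports Defs
begin

text \<open>
  In \<open>M\<close> there is a set \<open>D\<close> of all dense subsets of \<open>P\<close>, so a descending sequence meeting every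
  dense set can be built by recursion, provided that the order of \<open>P\<close> is decidable. The atomic
  diagram decides membership, but not whether a given element is a given ordered pair. With
  suitable sets of singletons and of unordered pairs as parameters this becomes decidable: the
  singleton of \<open>p\<close> is the first member of the set of singletons that contains \<open>p\<close>, and for
  distinct \<open>p\<close>, \<open>q\<close> the pair \<open>{p, q}\<close> is the first member of the set of pairs that contains both.
  In the same way the compatibility relation, being a set in \<open>M\<close>, is decidable. The filter
  generated by the sequence \<open>p\<^sub>n\<close> is then computable: for every \<open>q\<close> the conditions which are below
  \<open>q\<close> or incompatible with \<open>q\<close> form a dense set, so a search finds an \<open>n\<close> for which \<open>p\<^sub>n\<close> decides
  whether \<open>q\<close> is in the filter.
\<close>

section \<open>Relatively recursive total functions\<close>

definition recursive_in :: "(nat \<Rightarrow> nat \<Rightarrow> bool) \<Rightarrow> nat \<Rightarrow> (nat list \<Rightarrow> nat) \<Rightarrow> bool" where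
  "recursive_in R k f \<longleftrightarrow> (\<exists>g. \<forall>xs. length xs = k \<longrightarrow> computes R g xs (f xs))"

definition decidable_in :: "(nat \<Rightarrow> nat \<Rightarrow> bool) \<Rightarrow> nat \<Rightarrow> (nat list \<Rightarrow> bool) \<Rightarrow> bool" where
  "decidable_in R k Q \<longleftrightarrow> recursive_in R k (\<lambda>xs. if Q xs then 1 else 0)"

lemma recursive_in_cong:
  assumes "recursive_in R k f" "\<And>xs. length xs = k \<Longrightarrow> f xs = g xs"
  shows "recursive_in R k g"
  using assms unfolding recursive_in_def by metis

lemma recursive_in_nth: "i < k \<Longrightarrow> recursive_in R k (\<lambda>xs. xs ! i)"
  unfolding recursive_in_def by (rule exI[of _ "Proj i"]) (auto intro: computes.proj)

lemma recursive_in_hd: "0 < k \<Longrightarrow> recursive_in R k hd"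
  by (rule recursive_in_cong[OF recursive_in_nth[of 0]]) (auto simp: hd_conv_nth)

text \<open>The search rule presents the searched number as \<open>hd\<close> and the parameters
  through \<open>tl\<close>; this projection matches such goals.\<close>

lemma recursive_in_nth_tl: "Suc i < k \<Longrightarrow> recursive_in R k (\<lambda>xs. tl xs ! i)"
  by (rule recursive_in_cong[OF recursive_in_nth[of "Suc i"]]) (auto simp: nth_tl)

lemma recursive_in_comp:
  assumes "recursive_in R (length gs) f" "\<And>g. g \<in> set gs \<Longrightarrow> recursive_in R k g"
  shows "recursive_in R k (\<lambda>xs. f (map (\<lambda>g. g xs) gs))"
proof -
  obtain p where p: "\<And>xs. length xs = length gs \<Longrightarrow> computes R p xs (f xs)"
    using assms(1) unfolding recursive_in_def by blast
  obtain c where c: "\<And>g xs. g \<in> set gs \<Longrightarrow> length xs = k \<Longrightarrow> computes R (c g) xs (g xs)"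
    using assms(2) unfolding recursive_in_def by metis
  have "computes R (Comp p (map c gs)) xs (f (map (\<lambda>g. g xs) gs))" if "length xs = k" for xs
    using that c p
    by (intro computes.comp[where ys = "map (\<lambda>g. g xs) gs"])
      (auto simp: list_all2_map1 list_all2_map2 intro: list_all2_all_nthI)
  then show ?thesis unfolding recursive_in_def by blast
qed

lemma recursive_in_comp1:
  assumes "recursive_in R 1 (\<lambda>xs. f (xs ! 0))" "recursive_in R k g"
  shows "recursive_in R k (\<lambda>xs. f (g xs))"
  using recursive_in_comp[of R "[g]" "\<lambda>xs. f (xs ! 0)" k] assms by simp

lemma recursive_in_comp2:
  assumes "recursive_in R 2 (\<lambda>xs. f (xs ! 0) (xs ! 1))" "recursive_in R k g" "recursive_in R k h"
  shows "recursive_in R k (\<lambda>xs. f (g xs) (h xs))"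
  using recursive_in_comp[of R "[g, h]" "\<lambda>xs. f (xs ! 0) (xs ! 1)" k] assms
  by (auto simp: numeral_2_eq_2)

lemma decidable_in_comp2:
  assumes "decidable_in R 2 (\<lambda>xs. Q (xs ! 0) (xs ! 1))" "recursive_in R k g" "recursive_in R k h"
  shows "decidable_in R k (\<lambda>xs. Q (g xs) (h xs))"
  using recursive_in_comp2[of R "\<lambda>x y. if Q x y then 1 else 0"] assms
  unfolding decidable_in_def by simp

lemma recursive_in_const: "recursive_in R k (\<lambda>_. n)"
proof (induction n)
  case 0
  show ?case unfolding recursive_in_def by (blast intro: computes.zero)
next
  case (Suc n)
  have "recursive_in R 1 (\<lambda>xs. Suc (xs ! 0))"
    unfolding recursive_in_def
    by (rule exI[of _ Succ]) (auto simp: length_Suc_conv intro: computes.succ)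
  from recursive_in_comp1[OF this Suc] show ?case .
qed

lemma decidable_in_query:
  assumes "recursive_in R k f" "recursive_in R k g"
  shows "decidable_in R k (\<lambda>xs. R (f xs) (g xs))"
proof -
  have "decidable_in R 2 (\<lambda>xs. R (xs ! 0) (xs ! 1))"
    unfolding recursive_in_def decidable_in_def
    by (rule exI[of _ Query], clarsimp simp: length_Suc_conv numeral_2_eq_2
        simp del: One_nat_def split del: if_split) (rule computes.query)
  from decidable_in_comp2[OF this assms] show ?thesis .
qed

lemma recursive_in_primrec:
  assumes "recursive_in R k f" "recursive_in R (Suc (Suc k)) g"
    and "\<And>xs. h 0 xs = f xs" "\<And>n xs. h (Suc n) xs = g (n # h n xs # xs)"
  shows "recursive_in R (Suc k) (\<lambda>xs. h (hd xs) (tl xs))"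
proof -
  obtain p q where p: "\<And>xs. length xs = k \<Longrightarrow> computes R p xs (f xs)"
    and q: "\<And>xs. length xs = Suc (Suc k) \<Longrightarrow> computes R q xs (g xs)"
    using assms(1,2) unfolding recursive_in_def by blast
  have "computes R (PrimRec p q) (n # xs) (h n xs)" if "length xs = k" for n xs
    by (induction n) (auto simp: assms(3,4) that intro!: p q intro: computes.primrec_0 computes.primrec_Suc)
  then show ?thesis unfolding recursive_in_def
    by (intro exI[of _ "PrimRec p q"]) (auto simp: length_Suc_conv)
qed

text \<open>The condition becomes the number 0 or 1, and a primitive recursion on it makes the
  selection. Both branches are evaluated, which is harmless because both are total.\<close>

lemma recursive_in_if:
  assumes "decidable_in R k Q" "recursive_in R k f" "recursive_in R k g"
  shows "recursive_in R k (\<lambda>xs. if Q xs then f xs else g xs)"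
proof -
  define h where "h = rec_nat (\<lambda>xs::nat list. xs ! 1) (\<lambda>_ _ xs. xs ! 0)"
  have "recursive_in R (Suc 2) (\<lambda>xs. h (hd xs) (tl xs))"
    \<comment> \<open>The step function reads entry 2 because the predecessor and the previous value
      precede the parameters.\<close>
    by (rule recursive_in_primrec[where f = "\<lambda>xs. xs ! 1" and g = "\<lambda>xs. xs ! 2"])
      (auto intro: recursive_in_nth simp: h_def)
  then have "recursive_in R k (\<lambda>xs. (\<lambda>xs. h (hd xs) (tl xs))
      (map (\<lambda>g. g xs) [\<lambda>xs. if Q xs then 1 else 0, f, g]))"
    using assms unfolding decidable_in_def
    by (intro recursive_in_comp) (auto simp: eval_nat_numeral)
  then show ?thesis by (rule recursive_in_cong) (auto simp: h_def)
qed

lemma decidable_in_if: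
  assumes "decidable_in R k Q" "decidable_in R k S" "decidable_in R k T"
  shows "decidable_in R k (\<lambda>xs. if Q xs then S xs else T xs)"
  using recursive_in_if[OF assms(1) assms(2,3)[unfolded decidable_in_def]]
  unfolding decidable_in_def by (rule recursive_in_cong) auto

lemma decidable_in_const: "decidable_in R k (\<lambda>_. b)"
  unfolding decidable_in_def by (rule recursive_in_const)

lemma decidable_in_not: "decidable_in R k Q \<Longrightarrow> decidable_in R k (\<lambda>xs. \<not> Q xs)"
  using decidable_in_if[OF _ decidable_in_const[of R k False] decidable_in_const[of R k True], of Q]
  by (simp add: if_bool_eq_conj)

lemma decidable_in_conj:
  "decidable_in R k Q \<Longrightarrow> decidable_in R k S \<Longrightarrow> decidable_in R k (\<lambda>xs. Q xs \<and> S xs)"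
  using decidable_in_if[OF _ _ decidable_in_const[of R k False], of Q S]
  by (simp add: if_bool_eq_disj)

lemma decidable_in_disj:
  "decidable_in R k Q \<Longrightarrow> decidable_in R k S \<Longrightarrow> decidable_in R k (\<lambda>xs. Q xs \<or> S xs)"
  using decidable_in_not[OF decidable_in_conj[OF decidable_in_not decidable_in_not], of R k Q S]
  by simp

text \<open>Minimisation looks for the value 0, so the program used decides the negation of
  \<open>Q\<close>. A witness for every argument list makes the search total.\<close>

lemma recursive_in_Least:
  assumes "decidable_in R (Suc k) (\<lambda>xs. Q (hd xs) (tl xs))"
    and ex: "\<And>xs. length xs = k \<Longrightarrow> \<exists>n. Q n xs"
  shows "recursive_in R k (\<lambda>xs. LEAST n. Q n xs)"
proof -
  obtain p where p: "\<And>xs. length xs = Suc k \<Longrightarrow>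
      computes R p xs (if \<not> Q (hd xs) (tl xs) then 1 else 0)"
    using decidable_in_not[OF assms(1)] unfolding decidable_in_def recursive_in_def by blast
  have "computes R (Mu p) xs (LEAST n. Q n xs)" if len: "length xs = k" for xs
  proof (rule computes.mu)
    have "Q (LEAST n. Q n xs) xs" using ex[OF len] by (rule LeastI_ex)
    then show "computes R p ((LEAST n. Q n xs) # xs) 0"
      using p[of "(LEAST n. Q n xs) # xs"] len by simp
    show "\<forall>m<(LEAST n. Q n xs). \<exists>y>0. computes R p (m # xs) y"
    proof (intro allI impI)
      fix m assume "m < (LEAST n. Q n xs)"
      then have "\<not> Q m xs" by (rule not_less_Least)
      then show "\<exists>y>0. computes R p (m # xs) y"
        using p[of "m # xs"] len by (intro exI[of _ 1]) simp
    qed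
  qed
  then show ?thesis unfolding recursive_in_def by blast
qed

lemmas recursive_in_intros =
  recursive_in_nth recursive_in_hd recursive_in_nth_tl recursive_in_const
  decidable_in_query decidable_in_const decidable_in_not decidable_in_conj decidable_in_disj

section \<open>Formulas and sets of the model\<close>

definition All :: "nat \<Rightarrow> fm \<Rightarrow> fm" where "All i \<phi> = Neg (Exi i (Neg \<phi>))"
definition Disj :: "fm \<Rightarrow> fm \<Rightarrow> fm" where "Disj \<phi> \<psi> = Neg (Conj (Neg \<phi>) (Neg \<psi>))"
definition Imp :: "fm \<Rightarrow> fm \<Rightarrow> fm" where "Imp \<phi> \<psi> = Neg (Conj \<phi> (Neg \<psi>))"
definition Iff :: "fm \<Rightarrow> fm \<Rightarrow> fm" where "Iff \<phi> \<psi> = Conj (Imp \<phi> \<psi>) (Imp \<psi> \<phi>)"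

lemma sat_connectives [simp]:
  "sat E v (All i \<phi>) \<longleftrightarrow> (\<forall>x. sat E (v(i := x)) \<phi>)"
  "sat E v (Disj \<phi> \<psi>) \<longleftrightarrow> sat E v \<phi> \<or> sat E v \<psi>"
  "sat E v (Imp \<phi> \<psi>) \<longleftrightarrow> (sat E v \<phi> \<longrightarrow> sat E v \<psi>)"
  "sat E v (Iff \<phi> \<psi>) \<longleftrightarrow> (sat E v \<phi> \<longleftrightarrow> sat E v \<psi>)"
  by (auto simp: All_def Disj_def Imp_def Iff_def)

text \<open>Bound variables are reserved by level: 9 here, 7 and 8 for ordered pairs, 6 for the
  order, 5 for compatibility. The index bounds in the \<open>sat\<close> rules thus exclude
  capture.\<close>

definition upair_fm :: "nat \<Rightarrow> nat \<Rightarrow> nat \<Rightarrow> fm" where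
  "upair_fm i j k = All 9 (Iff (Mem 9 k) (Disj (Eql 9 i) (Eql 9 j)))"

definition opair_fm :: "nat \<Rightarrow> nat \<Rightarrow> nat \<Rightarrow> fm" where
  "opair_fm i j k =
     Exi 7 (Exi 8 (Conj (upair_fm i i 7) (Conj (upair_fm i j 8) (upair_fm 7 8 k))))"

definition related_fm :: "nat \<Rightarrow> nat \<Rightarrow> nat \<Rightarrow> fm" where
  "related_fm l i j = Exi 6 (Conj (opair_fm i j 6) (Mem 6 l))"

lemma sat_upair_fm [simp]:
  "i < 9 \<Longrightarrow> j < 9 \<Longrightarrow> k < 9 \<Longrightarrow> sat E v (upair_fm i j k) \<longleftrightarrow> is_upair E (v i) (v j) (v k)"
  by (simp add: upair_fm_def is_upair_def)

lemma sat_opair_fm [simp]: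
  "i < 7 \<Longrightarrow> j < 7 \<Longrightarrow> k < 7 \<Longrightarrow> sat E v (opair_fm i j k) \<longleftrightarrow> is_opair E (v i) (v j) (v k)"
  by (simp add: opair_fm_def is_opair_def)

lemma sat_related_fm [simp]:
  "l < 6 \<Longrightarrow> i < 6 \<Longrightarrow> j < 6 \<Longrightarrow> sat E v (related_fm l i j) \<longleftrightarrow> related E (v l) (v i) (v j)"
  by (simp add: related_fm_def related_def)

section \<open>Kuratowski pairs in the model\<close>

lemma is_upair_unique:
  "extensionality E \<Longrightarrow> is_upair E x y z \<Longrightarrow> is_upair E x y z' \<Longrightarrow> z = z'"
  unfolding extensionality_def is_upair_def by blast

lemma is_upair_inject:
  assumes "is_upair E x y z" "is_upair E x' y' z"
  shows "x = x' \<and> y = y' \<or> x = y' \<and> y = x'"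
proof -
  have "{x, y} = {x', y'}" using assms unfolding is_upair_def by blast
  then show ?thesis by (simp add: doubleton_eq_iff)
qed

lemma is_opair_inject:
  assumes "is_opair E p q r" "is_opair E p' q' r"
  shows "p = p' \<and> q = q'"
proof -
  obtain s t s' t' where
    st: "is_upair E p p s" "is_upair E p q t" "is_upair E s t r" and
    st': "is_upair E p' p' s'" "is_upair E p' q' t'" "is_upair E s' t' r"
    using assms unfolding is_opair_def by blast
  from is_upair_inject[OF st(3) st'(3)] show ?thesis
  proof
    assume "s = s' \<and> t = t'"
    then show ?thesis
      using is_upair_inject[of E p p s p' p'] is_upair_inject[of E p q t p' q'] st st' by auto
  next
    assume "s = t' \<and> t = s'"
    then show ?thesis
      using is_upair_inject[of E p p s p' q'] is_upair_inject[of E p q t p' p'] st st' by auto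
  qed
qed

lemma is_opair_unique:
  "extensionality E \<Longrightarrow> is_opair E x y z \<Longrightarrow> is_opair E x y z' \<Longrightarrow> z = z'"
  unfolding is_opair_def by (metis is_upair_unique)

section \<open>Sets obtained by separation\<close>

lemma ex_subset_sat:
  assumes "separation E"
  shows "\<exists>b. \<forall>x. E x b \<longleftrightarrow> E x a \<and> sat E (v(0 := x)) \<phi>"
  using assms unfolding separation_def by blast

lemma ex_singletons:
  assumes "separation E"
  shows "\<exists>b. \<forall>x. E x b \<longleftrightarrow> E x a \<and> (\<exists>y. is_upair E y y x)"
  using ex_subset_sat[OF assms, of a undefined "Exi 1 (upair_fm 1 1 0)"] by simp

lemma ex_upairs:
  assumes "separation E"
  shows "\<exists>b. \<forall>x. E x b \<longleftrightarrow> E x a \<and> (\<exists>y z. is_upair E y z x)"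
  using ex_subset_sat[OF assms, of a undefined "Exi 1 (Exi 2 (upair_fm 1 2 0))"] by simp

text \<open>Once coded by a set, density is decided by one membership query. The power set accounts
  for inclusion in \<open>P\<close>, so the formula only states the extension property.\<close>

lemma ex_dense_sets:
  assumes "separation E" "power_set E"
  shows "\<exists>b. \<forall>D. E D b \<longleftrightarrow> is_dense E P L D"
proof -
  obtain PP where "\<And>z. E z PP \<longleftrightarrow> (\<forall>w. E w z \<longrightarrow> E w P)"
    using assms(2) unfolding power_set_def by blast
  then show ?thesis
    using ex_subset_sat[OF assms(1), of PP "(\<lambda>_. 0)(1 := P, 2 := L)"
        "All 3 (Imp (Mem 3 1) (Exi 4 (Conj (Mem 4 0) (related_fm 2 4 3))))"]
    by (simp add: is_dense_def)
qed

definition compatible :: "(nat \<Rightarrow> nat \<Rightarrow> bool) \<Rightarrow> nat \<Rightarrow> nat \<Rightarrow> nat \<Rightarrow> nat \<Rightarrow> bool" where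
  "compatible E P L p q \<longleftrightarrow> (\<exists>c. E c P \<and> related E L c p \<and> related E L c q)"

definition compatible_fm :: "nat \<Rightarrow> nat \<Rightarrow> nat \<Rightarrow> nat \<Rightarrow> fm" where
  "compatible_fm k l i j = Exi 5 (Conj (Mem 5 k) (Conj (related_fm l 5 i) (related_fm l 5 j)))"

lemma sat_compatible_fm [simp]:
  "k < 5 \<Longrightarrow> l < 5 \<Longrightarrow> i < 5 \<Longrightarrow> j < 5 \<Longrightarrow>
    sat E v (compatible_fm k l i j) \<longleftrightarrow> compatible E (v k) (v l) (v i) (v j)"
  by (simp add: compatible_fm_def compatible_def)

text \<open>This set will turn out to be dense, so the sequence meets it and thereby decides
  \<open>q\<close>.\<close>

lemma ex_deciding_set:
  assumes "separation E"
  shows "\<exists>b. \<forall>p. E p b \<longleftrightarrow> E p P \<and> (related E L p q \<or> \<not> compatible E P L p q)"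
  using ex_subset_sat[OF assms, of P "(\<lambda>_. 0)(1 := P, 2 := L, 3 := q)"
      "Disj (related_fm 2 0 3) (Neg (compatible_fm 1 2 0 3))"]
  by simp

text \<open>Pairs of conditions therefore lie in the double power set of \<open>P\<close>, from
  which separation can cut out relations on \<open>P\<close>.\<close>

lemma opair_subset_Pow:
  assumes "is_opair E p q r" "E p P" "E q P" "\<And>z. E z PP \<longleftrightarrow> (\<forall>w. E w z \<longrightarrow> E w P)" "E w r"
  shows "E w PP"
proof -
  obtain s t where "is_upair E p p s" "is_upair E p q t" "is_upair E s t r"
    using assms(1) unfolding is_opair_def by blast
  then show ?thesis using assms(2-5) by (auto simp: is_upair_def)
qed

lemma ex_upair: "pairing E \<Longrightarrow> \<exists>z. is_upair E x y z"
  unfolding pairing_def is_upair_def by blast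

text \<open>An unordered pair with two distinct known members has no others. Once the first conjunct
  is coded by a set, the left side is a conjunction of atomic queries.\<close>

lemma is_upair_iff_members:
  assumes "E p P" "E q P" "p \<noteq> q"
  shows "((\<forall>w. E w t \<longrightarrow> E w P) \<and> (\<exists>y z. is_upair E y z t)) \<and> E p t \<and> E q t \<longleftrightarrow> is_upair E p q t"
proof
  assume "((\<forall>w. E w t \<longrightarrow> E w P) \<and> (\<exists>y z. is_upair E y z t)) \<and> E p t \<and> E q t"
  then show "is_upair E p q t" using assms(3) unfolding is_upair_def by auto
next
  assume "is_upair E p q t"
  then show "((\<forall>w. E w t \<longrightarrow> E w P) \<and> (\<exists>y z. is_upair E y z t)) \<and> E p t \<and> E q t"
    using assms(1,2) by (auto simp: is_upair_def)
qed

lemma ex_opair: "pairing E \<Longrightarrow> \<exists>r. is_opair E p q r"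
  unfolding is_opair_def by (meson ex_upair)

text \<open>A direct search for a common extension need not halt; coding compatibility by a set of
  the model avoids that search.\<close>

lemma ex_compatibility:
  assumes "separation E" "power_set E" "pairing E" "extensionality E"
  shows "\<exists>C. \<forall>p q. E p P \<and> E q P \<longrightarrow> (related E C p q \<longleftrightarrow> compatible E P L p q)"
proof -
  obtain PP where PP: "\<And>z. E z PP \<longleftrightarrow> (\<forall>w. E w z \<longrightarrow> E w P)"
    using assms(2) unfolding power_set_def by blast
  obtain PPP where PPP: "\<And>z. E z PPP \<longleftrightarrow> (\<forall>w. E w z \<longrightarrow> E w PP)"
    using assms(2) unfolding power_set_def by blast
  obtain C where C: "\<And>r. E r C \<longleftrightarrow> E r PPP \<and> (\<exists>p q. is_opair E p q r \<and> compatible E P L p q)"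
    using ex_subset_sat[OF assms(1), of PPP "(\<lambda>_. 0)(1 := P, 2 := L)"
        "Exi 3 (Exi 4 (Conj (opair_fm 3 4 0) (compatible_fm 1 2 3 4)))"]
    by auto
  have "related E C p q \<longleftrightarrow> compatible E P L p q" if pq: "E p P" "E q P" for p q
  proof
    assume "related E C p q"
    then obtain r p' q' where "is_opair E p q r" "is_opair E p' q' r" "compatible E P L p' q'"
      using C unfolding related_def by blast
    then show "compatible E P L p q" using is_opair_inject[of E p q r p' q'] by simp
  next
    assume "compatible E P L p q"
    moreover obtain r where r: "is_opair E p q r" using ex_opair[OF assms(3)] by blast
    moreover have "E r PPP" using opair_subset_Pow[OF r pq PP] PPP by blast
    ultimately show "related E C p q" using C unfolding related_def by blast
  qed
  then show ?thesis by blast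
qed

section \<open>Deciding relations coded in the model\<close>

text \<open>
  The searches are guarded so that they also halt on arguments outside \<open>P\<close>. The diagonal is treated
  separately because the pair \<open>(p, p)\<close> is a singleton; the singleton of \<open>p\<close> also serves to
  decide whether \<open>p = q\<close>.
\<close>

lemma decidable_related:
  assumes sep: "separation E" and pow: "power_set E" and pai: "pairing E" and ext: "extensionality E"
  shows "\<exists>Q. decidable_in E 2 (\<lambda>xs. Q (xs ! 0) (xs ! 1)) \<and>
    (\<forall>p q. E p P \<and> E q P \<longrightarrow> (Q p q \<longleftrightarrow> p = q \<or> related E W p q))"
proof -
  obtain PP where PP: "\<And>z. E z PP \<longleftrightarrow> (\<forall>w. E w z \<longrightarrow> E w P)"
    using pow unfolding power_set_def by blast
  obtain PPP where PPP: "\<And>z. E z PPP \<longleftrightarrow> (\<forall>w. E w z \<longrightarrow> E w PP)"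
    using pow unfolding power_set_def by blast
  obtain A where A: "\<And>x. E x A \<longleftrightarrow> E x PP \<and> (\<exists>y. is_upair E y y x)"
    using ex_singletons[OF sep] by blast
  obtain B where B: "\<And>x. E x B \<longleftrightarrow> E x PP \<and> (\<exists>y z. is_upair E y z x)"
    using ex_upairs[OF sep] by blast
  obtain C where C: "\<And>x. E x C \<longleftrightarrow> E x PPP \<and> (\<exists>y z. is_upair E y z x)"
    using ex_upairs[OF sep] by blast
  note upair_ex = ex_upair[OF pai]
  have A_iff: "E s A \<and> E p s \<longleftrightarrow> is_upair E p p s" if "E p P" for p s
    using that unfolding A PP is_upair_def by auto
  have B_iff: "E t B \<and> E p t \<and> E q t \<longleftrightarrow> is_upair E p q t" if "E p P" "E q P" "p \<noteq> q" for p q t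
    using that unfolding B PP by (rule is_upair_iff_members)
  have C_iff: "E r C \<and> E s r \<and> E t r \<longleftrightarrow> is_upair E s t r" if "E s PP" "E t PP" "s \<noteq> t" for s t r
    using that unfolding C PPP by (rule is_upair_iff_members)

  define S where "S p = (LEAST s. \<not> E p P \<or> E s A \<and> E p s)" for p
  define bad where "bad p q \<longleftrightarrow> \<not> E p P \<or> \<not> E q P \<or> E q (S p)" for p q
  \<comment> \<open>In the bad case \<open>T\<close> and \<open>U\<close> default to 0. Then
    \<open>Q\<close> carries no information off \<open>P\<close>, while on the diagonal of
    \<open>P\<close> its first disjunct holds.\<close>
  define T where "T p q = (LEAST t. bad p q \<or> E t B \<and> E p t \<and> E q t)" for p q
  define U where "U p q = (LEAST r. bad p q \<or> E r C \<and> E (S p) r \<and> E (T p q) r)" for p q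
  define Q where "Q p q \<longleftrightarrow> E q (S p) \<or> E (U p q) W" for p q

  have S: "is_upair E p p (S p)" if "E p P" for p
    using LeastI_ex[of "\<lambda>s. \<not> E p P \<or> E s A \<and> E p s"] upair_ex A_iff[OF that] that
    unfolding S_def by blast
  have ok: "E p P \<and> E q P \<and> p \<noteq> q" if "\<not> bad p q" for p q
    using that S[of p] unfolding bad_def is_upair_def by blast
  have T_ex: "\<exists>t. bad p q \<or> E t B \<and> E p t \<and> E q t" for p q
    using ok upair_ex B_iff by blast
  have T: "is_upair E p q (T p q)" if "\<not> bad p q" for p q
    using LeastI_ex[OF T_ex[of p q]] that ok[OF that] B_iff unfolding T_def by blast
  \<comment> \<open>\<open>q\<close> belongs to \<open>T p q\<close> but not to \<open>S p\<close>;
    being distinct, these two sets satisfy the hypotheses of the pair criterion for the outer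
    pair.\<close>
  have ST: "E (S p) PP \<and> E (T p q) PP \<and> S p \<noteq> T p q" if "\<not> bad p q" for p q
    using S[of p] T[OF that] ok[OF that] unfolding PP is_upair_def by auto
  have U_ex: "\<exists>r. bad p q \<or> E r C \<and> E (S p) r \<and> E (T p q) r" for p q
    using ST upair_ex C_iff by blast
  have U: "is_opair E p q (U p q)" if "\<not> bad p q" for p q
  proof -
    have "is_upair E (S p) (T p q) (U p q)"
      using LeastI_ex[OF U_ex[of p q]] that ST[OF that] C_iff unfolding U_def by blast
    then show ?thesis using S ok[OF that] T[OF that] unfolding is_opair_def by blast
  qed
  have Q_iff: "Q p q \<longleftrightarrow> p = q \<or> related E W p q" if pq: "E p P" "E q P" for p q
  proof (cases "p = q")
    case True
    then show ?thesis using S[of p] pq unfolding Q_def is_upair_def by blast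
  next
    case False
    then have nE: "\<not> E q (S p)" using S[of p] pq by (auto simp: is_upair_def)
    then have "\<not> bad p q" using pq unfolding bad_def by blast
    from U[OF this] have "related E W p q \<longleftrightarrow> E (U p q) W"
      unfolding related_def using is_opair_unique[OF ext] by blast
    then show ?thesis using False nE unfolding Q_def by blast
  qed

  have S_ex: "\<exists>s. \<not> E p P \<or> E s A \<and> E p s" for p using S A_iff by blast
  have "recursive_in E 1 (\<lambda>xs. S (xs ! 0))"
    unfolding S_def
    by (rule recursive_in_Least) (intro recursive_in_intros | rule S_ex | simp)+
  note S_rec = recursive_in_comp1[OF this]
  have bad_dec: "decidable_in E k (\<lambda>xs. bad (f xs) (g xs))"
    if "recursive_in E k f" "recursive_in E k g" for k f g
    unfolding bad_def by (intro recursive_in_intros S_rec that)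
  have "recursive_in E 2 (\<lambda>xs. T (xs ! 0) (xs ! 1))"
    unfolding T_def
    by (rule recursive_in_Least) (intro recursive_in_intros bad_dec | rule T_ex | simp)+
  note T_rec = recursive_in_comp2[OF this]
  have "recursive_in E 2 (\<lambda>xs. U (xs ! 0) (xs ! 1))"
    unfolding U_def
    by (rule recursive_in_Least)
      (intro recursive_in_intros bad_dec S_rec T_rec | rule U_ex | simp)+
  then have "decidable_in E 2 (\<lambda>xs. Q (xs ! 0) (xs ! 1))"
    unfolding Q_def by (intro recursive_in_intros S_rec) simp_all
  then show ?thesis using Q_iff by blast
qed

section \<open>The generic filter\<close>

theorem theorem4p1:
  fixes E :: "nat \<Rightarrow> nat \<Rightarrow> bool" and \<PP> P L :: nat
  assumes "model_ZF E"
    and "notion_of_forcing E \<PP> P L"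
  shows "\<exists>G :: nat set. generic_filter E P L G \<and> computable_from E G"
proof -
  have zf: "separation E" "power_set E" "pairing E" "extensionality E"
    using assms(1) unfolding model_ZF_def by auto
  have refl: "related E L p p" if "E p P" for p
    using assms(2) that unfolding notion_of_forcing_def by blast
  have trans: "related E L p r" if "related E L p q" "related E L q r" "E p P" "E q P" "E r P" for p q r
    using assms(2) that unfolding notion_of_forcing_def by blast
  obtain p0 where p0: "E p0 P" using assms(2) unfolding notion_of_forcing_def by blast

  obtain \<D> where \<D>: "\<And>D. E D \<D> \<longleftrightarrow> is_dense E P L D"
    using ex_dense_sets[OF zf(1,2)] by blast
  obtain C where C: "\<And>p q. E p P \<Longrightarrow> E q P \<Longrightarrow> related E C p q \<longleftrightarrow> compatible E P L p q"
    using ex_compatibility[OF zf] by blast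
  \<comment> \<open>Reflexivity absorbs the alternative \<open>p = q\<close> of the decision
    procedure.\<close>
  obtain le where "decidable_in E 2 (\<lambda>xs. le (xs ! 0) (xs ! 1))"
    and le: "\<And>p q. E p P \<Longrightarrow> E q P \<Longrightarrow> le p q \<longleftrightarrow> related E L p q"
    using decidable_related[OF zf, of P L] refl by blast
  note le_dec = decidable_in_comp2[OF this(1)]
  \<comment> \<open>Here the diagonal is absorbed because each condition is a common extension of
    itself with itself.\<close>
  obtain comp where "decidable_in E 2 (\<lambda>xs. comp (xs ! 0) (xs ! 1))"
    and comp: "\<And>p q. E p P \<Longrightarrow> E q P \<Longrightarrow> comp p q \<longleftrightarrow> compatible E P L p q"
    using decidable_related[OF zf, of P C] refl C unfolding compatible_def by blast
  note comp_dec = decidable_in_comp2[OF this(1)]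

  \<comment> \<open>The two negated guards make the search succeed on all arguments; for dense
    \<open>D\<close> and a condition \<open>p\<close> it finds the first member of \<open>D\<close>
    below \<open>p\<close>.\<close>
  define ext where
    "ext D p = (LEAST d. \<not> E D \<D> \<or> \<not> E p P \<or> E d D \<and> le d p)" for D p
  have ext_ex: "\<exists>d. \<not> E D \<D> \<or> \<not> E p P \<or> E d D \<and> le d p" for D p
    using \<D>[of D] le unfolding is_dense_def by blast
  have "recursive_in E 2 (\<lambda>xs. ext (xs ! 0) (xs ! 1))"
    unfolding ext_def
    by (rule recursive_in_Least) (intro recursive_in_intros le_dec | rule ext_ex | simp)+
  note ext_rec = recursive_in_comp2[OF this]
  have ext: "E (ext D p) D" "E (ext D p) P" "related E L (ext D p) p" if "E D \<D>" "E p P" for D p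
  proof -
    have *: "E (ext D p) D \<and> le (ext D p) p"
      using LeastI_ex[OF ext_ex[of D p]] that unfolding ext_def by blast
    then show "E (ext D p) D" "E (ext D p) P" "related E L (ext D p) p"
      using le that \<D> unfolding is_dense_def by blast+
  qed

  \<comment> \<open>No enumeration of dense sets is required: stage \<open>n\<close> treats the
    number \<open>n\<close> itself as a candidate and changes nothing if it is not dense.\<close>
  define a where "a = rec_nat p0 (\<lambda>n p. if E n \<D> then ext n p else p)"
  have a_Suc: "a (Suc n) = (if E n \<D> then ext n (a n) else a n)" for n by (simp add: a_def)
  have "recursive_in E (Suc (Suc 0)) (\<lambda>xs. if E (xs ! 0) \<D> then ext (xs ! 0) (xs ! 1) else xs ! 1)"
    by (intro recursive_in_if recursive_in_intros ext_rec) simp_all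
  then have "recursive_in E (Suc 0) (\<lambda>xs. a (hd xs))"
    by (rule recursive_in_primrec[OF recursive_in_const[of E 0 p0], where h = "\<lambda>n _. a n"])
      (simp_all add: a_def)
  then have "recursive_in E 1 (\<lambda>xs. a (xs ! 0))"
    unfolding One_nat_def by (rule recursive_in_cong) (auto simp: length_Suc_conv)
  note a_rec = recursive_in_comp1[OF this]
  have aP: "E (a n) P" for n
    by (induction n) (simp_all add: a_Suc ext(2), simp add: a_def p0)
  have a_mono: "related E L (a n) (a m)" if "m \<le> n" for m n
    using that
  proof (induction n rule: dec_induct)
    case base
    show ?case using refl aP by blast
  next
    case (step n)
    have "related E L (a (Suc n)) (a n)" using ext refl aP by (auto simp: a_Suc)
    then show ?case using step trans aP by blast
  qed
  \<comment> \<open>The set \<open>D\<close> is met on passing from \<open>a D\<close> to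
    \<open>a (Suc D)\<close>, hence the witness \<open>Suc D\<close>.\<close>
  have a_dense: "\<exists>n. E (a n) D" if "is_dense E P L D" for D
    using a_Suc[of D] ext(1)[OF _ aP] that \<D> by (intro exI[of _ "Suc D"]) simp

  \<comment> \<open>The quantifier over stages only shows that \<open>G\<close> is enumerable
    relative to \<open>E\<close>; deciding it needs a bound on the stage.\<close>
  define G where "G = {q. E q P \<and> (\<exists>n. related E L (a n) q)}"
  have "generic_filter E P L G"
    unfolding generic_filter_def is_filter_on_def
  proof (intro conjI ballI allI impI)
    show "G \<subseteq> {p. E p P}" "G \<noteq> {}" using p0 aP refl unfolding G_def by blast+
  next
    fix p q assume "p \<in> G" "E q P \<and> related E L p q"
    then show "q \<in> G" using trans aP unfolding G_def by blast
  next
    fix p q assume "p \<in> G" "q \<in> G"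
    then obtain m n where mn: "E p P" "E q P" "related E L (a m) p" "related E L (a n) q"
      unfolding G_def by blast
    \<comment> \<open>The sequence descends, so the later of the two stages lies below both
      conditions.\<close>
    have "related E L (a (max m n)) p" "related E L (a (max m n)) q"
      using trans[OF a_mono[of m "max m n"]] trans[OF a_mono[of n "max m n"]] mn aP by simp_all
    then show "\<exists>r\<in>G. related E L r p \<and> related E L r q"
      using refl aP unfolding G_def by blast
  next
    fix D assume "is_dense E P L D"
    then show "\<exists>d\<in>G. E d D" using a_dense aP refl unfolding G_def by blast
  qed

  moreover have "computable_from E G"
  proof -
    \<comment> \<open>\<open>N q\<close> is the first stage that decides \<open>q\<close>; for
      \<open>q\<close> outside \<open>P\<close> the guard stops the search at 0.\<close>
    define N where "N q = (LEAST n. \<not> E q P \<or> le (a n) q \<or> \<not> comp (a n) q)" for q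
    have N_ex: "\<exists>n. \<not> E q P \<or> le (a n) q \<or> \<not> comp (a n) q" for q
    proof (cases "E q P")
      case True
      obtain D where D: "\<And>p. E p D \<longleftrightarrow> E p P \<and> (related E L p q \<or> \<not> compatible E P L p q)"
        using ex_deciding_set[OF zf(1)] by blast
      \<comment> \<open>If \<open>p\<close> is compatible with \<open>q\<close>, a common extension
        belongs to \<open>D\<close>; otherwise \<open>p\<close> itself does.\<close>
      have "is_dense E P L D"
        unfolding is_dense_def
      proof (intro conjI allI impI)
        fix p assume p: "E p P"
        show "\<exists>d. E d D \<and> related E L d p"
          using D refl p unfolding compatible_def by (cases "compatible E P L p q") (auto simp: compatible_def)
      qed (use D in blast)
      then obtain n where "E (a n) D" using a_dense by blast
      then show ?thesis using D True aP le comp by blast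
    qed simp
    have "recursive_in E 1 (\<lambda>xs. N (xs ! 0))"
      unfolding N_def
      by (rule recursive_in_Least)
        (intro recursive_in_intros le_dec comp_dec a_rec | rule N_ex | simp)+
    note N_rec = recursive_in_comp1[OF this]
    have "decidable_in E 1 (\<lambda>xs. E (xs ! 0) P \<and> le (a (N (xs ! 0))) (xs ! 0))"
      by (intro recursive_in_intros le_dec a_rec N_rec) simp_all
    moreover have "q \<in> G \<longleftrightarrow> E q P \<and> le (a (N q)) q" for q
    proof (cases "E q P")
      case True
      \<comment> \<open>Otherwise stage \<open>N q\<close> is incompatible with \<open>q\<close>,
        although the later of the stages \<open>m\<close> and \<open>N q\<close> extends
        both.\<close>
      have "le (a (N q)) q" if "related E L (a m) q" for m
      proof (rule ccontr)
        assume "\<not> le (a (N q)) q"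
        then have "\<not> compatible E P L (a (N q)) q"
          using LeastI_ex[OF N_ex[of q]] True comp aP unfolding N_def by blast
        moreover have "related E L (a (max m (N q))) q"
          using trans[OF a_mono[of m "max m (N q)"] that] aP True by simp
        ultimately show False using a_mono[of "N q" "max m (N q)"] aP unfolding compatible_def by auto
      qed
      then show ?thesis using True le aP unfolding G_def by blast
    qed (simp add: G_def)
    ultimately have "decidable_in E 1 (\<lambda>xs. xs ! 0 \<in> G)" by simp
    then obtain f where f: "\<And>xs. length xs = 1 \<Longrightarrow> computes E f xs (if xs ! 0 \<in> G then 1 else 0)"
      unfolding decidable_in_def recursive_in_def by blast
    show ?thesis unfolding computable_from_def
    proof (intro exI[of _ f] allI)
      fix n
      show "computes E f [n] (if n \<in> G then 1 else 0)" using f[of "[n]"] by simp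
    qed
  qed
  ultimately show ?thesis by blast
qed

end
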